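(* Let $\mathfrak{A}$ be a residuated lattice, $F$ a filter of $\mathfrak{A}$ and $P$ a prime filter of $\mathfrak{A}$ containing $F$. The following assertions are equivalent: (1) $P$ is an $F$-minimal prime filter; (2) $P=D_{F}(P)$; (3) for any $x\in A$, $P$ contains precisely one of $x$ or $(F:x)$ (that is, exactly one of $x\in P$ and $(F:x)\subseteq P$ holds).
   Context: A residuated lattice is an algebra $\mathfrak{A}=(A;\vee,\wedge,\odot,\rightarrow,0,1)$ such that $(A;\vee,\wedge,0,1)$ is a bounded lattice, $(A;\odot,1)$ is a commutative monoid, and $x\odot y\leq z$ iff $x\leq y\rightarrow z$ for all $x,y,z\in A$. A filter of $\mathfrak{A}$ is a non-empty subset $F\subseteq A$ such that $x,y\in F$ implies $x\odot y\in F$, and $x\in F$, $y\in A$ implies $x\vee y\in F$; it is proper if $F\neq A$. A proper filter $P$ is prime if $x\vee y\in P$ implies $x\in P$ or $y\in P$. An $F$-minimal prime filter is a minimal element (under inclusion) of the set of prime filters containing $F$. For $x\in A$, $(F:x)=\{a\in A\mid x\vee a\in F\}$. For a proper filter $H$, $D_F(H)=\{a\in A\mid x\vee a\in F\text{ for some }x\in A\setminus H\}$. *)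

theory Defs
  imports Main
begin

text \<open>
  The algebra is carried by the whole type.  The constants 0 and 1 are \<^term>\<open>bot\<close> and
  \<^term>\<open>top\<close>; in particular the monoid unit is the greatest element of the lattice.
\<close>

class residuated_lattice = bounded_lattice +
  fixes rmult :: "'a \<Rightarrow> 'a \<Rightarrow> 'a" (infixl "\<odot>" 72)
    and rimp :: "'a \<Rightarrow> 'a \<Rightarrow> 'a" (infixr "\<rightarrow>\<^sub>r" 71)
  assumes rmult_assoc: "(x \<odot> y) \<odot> z = x \<odot> (y \<odot> z)"
    and rmult_commute: "x \<odot> y = y \<odot> x"
    and rmult_top: "x \<odot> top = x"
    and residuation: "x \<odot> y \<le> z \<longleftrightarrow> x \<le> y \<rightarrow>\<^sub>r z"
begin

definition rl_filter :: "'a set \<Rightarrow> bool" where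
  "rl_filter F \<longleftrightarrow> F \<noteq> {} \<and> (\<forall>x\<in>F. \<forall>y\<in>F. x \<odot> y \<in> F) \<and> (\<forall>x\<in>F. \<forall>y. sup x y \<in> F)"

definition proper_filter :: "'a set \<Rightarrow> bool" where
  "proper_filter F \<longleftrightarrow> rl_filter F \<and> F \<noteq> UNIV"

definition prime_filter :: "'a set \<Rightarrow> bool" where
  "prime_filter P \<longleftrightarrow> proper_filter P \<and> (\<forall>x y. sup x y \<in> P \<longrightarrow> x \<in> P \<or> y \<in> P)"

definition minimal_prime_filter :: "'a set \<Rightarrow> 'a set \<Rightarrow> bool" where
  "minimal_prime_filter F P \<longleftrightarrow> prime_filter P \<and> F \<subseteq> P \<and>
     (\<forall>Q. prime_filter Q \<and> F \<subseteq> Q \<and> Q \<subseteq> P \<longrightarrow> Q = P)"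

text \<open>\<open>filter_quot F x\<close> is $(F : x)$ and \<open>filter_D F H\<close> is $D_F(H)$.\<close>

definition filter_quot :: "'a set \<Rightarrow> 'a \<Rightarrow> 'a set" where
  "filter_quot F x = {a. sup x a \<in> F}"

definition filter_D :: "'a set \<Rightarrow> 'a set \<Rightarrow> 'a set" where
  "filter_D F H = {a. \<exists>x. x \<notin> H \<and> sup x a \<in> F}"

end

end

theory Submission
  imports Defs
begin

text \<open>
  The three conditions are compared through the inclusion \<open>P \<subseteq> filter_D F P\<close>. The reverse
  inclusion \<open>filter_D F P \<subseteq> P\<close> is automatic: if \<open>sup x a \<in> F \<subseteq> P\<close> and \<open>x \<notin> P\<close>, then \<open>a \<in> P\<close> by
  primeness. For the same reason \<open>x \<notin> P\<close> always gives \<open>filter_quot F x \<subseteq> P\<close>, so condition (3) only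
  says that each \<open>x \<in> P\<close> has some \<open>a \<notin> P\<close> with \<open>sup x a \<in> F\<close>, and this is \<open>P \<subseteq> filter_D F P\<close>.

  If \<open>P \<subseteq> filter_D F P\<close> and \<open>Q \<subseteq> P\<close> is a prime filter containing \<open>F\<close>, then each \<open>a \<in> P\<close> has a
  witness \<open>x \<notin> P\<close>, hence \<open>x \<notin> Q\<close>, with \<open>sup x a \<in> F \<subseteq> Q\<close>; primeness of \<open>Q\<close> gives \<open>a \<in> Q\<close>. So \<open>P\<close> is
  minimal.

  The converse needs a way to construct primes. Let \<open>a \<in> P - filter_D F P\<close>. The complement of \<open>P\<close>
  together with all \<open>sup s a\<close>, \<open>s \<notin> P\<close>, is closed under joins, and it misses \<open>F\<close> exactly because
  \<open>a \<notin> filter_D F P\<close>. The prime filter theorem (\<open>prime_filter_separation\<close>) extends \<open>F\<close> to a prime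
  filter missing this set; it lies inside \<open>P\<close> and omits \<open>a\<close>, so \<open>P\<close> is not minimal.
\<close>

section \<open>Filters and their quotients\<close>

lemma rmult_mono_left:
  fixes x :: "'a::residuated_lattice"
  assumes "x \<le> y"
  shows "x \<odot> z \<le> y \<odot> z"
proof -
  have "y \<le> z \<rightarrow>\<^sub>r y \<odot> z"
    using residuation by blast
  then show ?thesis
    using assms residuation order_trans by blast
qed

lemma rmult_le_left:
  fixes x :: "'a::residuated_lattice"
  shows "x \<odot> y \<le> x"
  using rmult_mono_left[of y top x] by (metis rmult_commute rmult_top top_greatest)

text \<open>
  Multiplication by \<open>z\<close> is left adjoint to \<open>z \<rightarrow>\<^sub>r _\<close>, so it preserves joins; this is the
  half of that fact which bounds products of joins from above.
\<close>

lemma rmult_sup_le: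
  fixes x :: "'a::residuated_lattice"
  assumes "x \<odot> z \<le> w" and "y \<odot> z \<le> w"
  shows "sup x y \<odot> z \<le> w"
  using assms by (simp add: residuation)

text \<open>
  Expanding the product of joins, every term other than \<open>a \<odot> b\<close> has the factor \<open>x\<close>. This
  inequality is what makes filter quotients closed under multiplication.
\<close>

lemma sup_rmult_sup_le:
  fixes x :: "'a::residuated_lattice"
  shows "sup x a \<odot> sup x b \<le> sup x (a \<odot> b)"
proof (rule rmult_sup_le)
  show "x \<odot> sup x b \<le> sup x (a \<odot> b)"
    using rmult_le_left le_supI1 by blast
  have "sup x b \<odot> a \<le> sup x (a \<odot> b)"
    by (rule rmult_sup_le) (simp_all add: rmult_le_left le_supI1 rmult_commute[of b a])
  then show "a \<odot> sup x b \<le> sup x (a \<odot> b)"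
    by (simp add: rmult_commute)
qed

lemma rl_filter_upward:
  fixes F :: "'a::residuated_lattice set"
  assumes "rl_filter F" and "x \<in> F" and "x \<le> y"
  shows "y \<in> F"
  using assms by (metis rl_filter_def sup.absorb2)

lemma rl_filter_rmult:
  fixes F :: "'a::residuated_lattice set"
  assumes "rl_filter F" and "x \<in> F" and "y \<in> F"
  shows "x \<odot> y \<in> F"
  using assms by (simp add: rl_filter_def)

lemma subset_filter_quot:
  fixes F :: "'a::residuated_lattice set"
  assumes "rl_filter F"
  shows "F \<subseteq> filter_quot F x"
  using rl_filter_upward[OF assms] by (auto simp: filter_quot_def)

lemma rl_filter_filter_quot:
  fixes F :: "'a::residuated_lattice set"
  assumes F: "rl_filter F"
  shows "rl_filter (filter_quot F x)"
  unfolding rl_filter_def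
proof (intro conjI ballI allI)
  show "filter_quot F x \<noteq> {}"
    using subset_filter_quot[OF F, of x] F by (auto simp: rl_filter_def)
next
  fix a b assume "a \<in> filter_quot F x" "b \<in> filter_quot F x"
  then have "sup x a \<odot> sup x b \<in> F"
    using rl_filter_rmult[OF F] by (simp add: filter_quot_def)
  then show "a \<odot> b \<in> filter_quot F x"
    using rl_filter_upward[OF F _ sup_rmult_sup_le] by (simp add: filter_quot_def)
next
  fix a b assume "a \<in> filter_quot F x"
  then show "sup a b \<in> filter_quot F x"
    using F by (simp add: filter_quot_def rl_filter_def flip: sup_assoc)
qed

section \<open>The prime filter theorem\<close>

lemma rl_filter_Union_chain:
  fixes C :: "'a::residuated_lattice set set"
  assumes "C \<noteq> {}" and chain: "subset.chain UNIV C" and filters: "\<And>G. G \<in> C \<Longrightarrow> rl_filter G"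
  shows "rl_filter (\<Union>C)"
  unfolding rl_filter_def
proof (intro conjI ballI allI)
  show "\<Union>C \<noteq> {}"
    using assms(1) filters by (auto simp: rl_filter_def)
next
  fix x y assume "x \<in> \<Union>C" "y \<in> \<Union>C"
  then obtain G H where "G \<in> C" "x \<in> G" "H \<in> C" "y \<in> H" by blast
  moreover from this have "G \<subseteq> H \<or> H \<subseteq> G"
    using chain by (auto simp: subset_chain_def)
  ultimately show "x \<odot> y \<in> \<Union>C"
    using filters rl_filter_rmult by blast
next
  fix x y assume "x \<in> \<Union>C"
  then show "sup x y \<in> \<Union>C"
    using filters unfolding rl_filter_def by blast
qed

text \<open>
  Zorn's lemma gives a filter \<open>Q\<close> maximal among those above \<open>F\<close> that miss \<open>T\<close>. Its primeness comes
  from maximality applied to quotients rather than to generated filters, which would bring in powers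
  of elements. If \<open>sup x y \<in> Q\<close> with \<open>x, y \<notin> Q\<close>, then \<open>filter_quot Q x\<close> properly extends \<open>Q\<close> (by \<open>y\<close>)
  and so contains some \<open>t \<in> T\<close>. Now \<open>filter_quot Q t\<close> properly extends \<open>Q\<close> (by \<open>x\<close>) and so contains
  some \<open>u \<in> T\<close>. Then \<open>sup t u\<close> is in both \<open>Q\<close> and \<open>T\<close>.
\<close>

theorem prime_filter_separation:
  fixes F T :: "'a::residuated_lattice set"
  assumes F: "rl_filter F" and disj: "F \<inter> T = {}"
    and "T \<noteq> {}" and sup_closed: "\<And>t u. t \<in> T \<Longrightarrow> u \<in> T \<Longrightarrow> sup t u \<in> T"
  obtains Q where "prime_filter Q" and "F \<subseteq> Q" and "Q \<inter> T = {}"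
proof -
  define \<G> where "\<G> = {G. rl_filter G \<and> F \<subseteq> G \<and> G \<inter> T = {}}"
  have "\<exists>Q\<in>\<G>. \<forall>G\<in>\<G>. Q \<subseteq> G \<longrightarrow> G = Q"
  proof (rule subset_Zorn_nonempty)
    show "\<G> \<noteq> {}"
      using F disj by (auto simp: \<G>_def)
  next
    fix C assume "C \<noteq> {}" "subset.chain \<G> C"
    moreover from this have "rl_filter (\<Union>C)"
      by (intro rl_filter_Union_chain) (auto simp: subset_chain_def \<G>_def)
    ultimately show "\<Union>C \<in> \<G>"
      by (auto simp: subset_chain_def \<G>_def)
  qed
  then obtain Q where "Q \<in> \<G>" and maximal: "\<And>G. G \<in> \<G> \<Longrightarrow> Q \<subseteq> G \<Longrightarrow> G = Q"
    by blast
  then have Q: "rl_filter Q" "F \<subseteq> Q" "Q \<inter> T = {}"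
    by (auto simp: \<G>_def)
  have quot_meets: "\<exists>t\<in>T. sup x t \<in> Q" if "sup x y \<in> Q" "y \<notin> Q" for x y
  proof (rule ccontr)
    assume "\<not> (\<exists>t\<in>T. sup x t \<in> Q)"
    then have "filter_quot Q x \<in> \<G>"
      using Q rl_filter_filter_quot subset_filter_quot[OF Q(1), of x]
      by (auto simp: \<G>_def filter_quot_def)
    then have "filter_quot Q x = Q"
      using maximal subset_filter_quot[OF Q(1)] by blast
    then show False
      using that by (auto simp: filter_quot_def)
  qed
  have "x \<in> Q \<or> y \<in> Q" if xy: "sup x y \<in> Q" for x y
  proof (rule ccontr)
    assume "\<not> (x \<in> Q \<or> y \<in> Q)"
    then obtain t where t: "t \<in> T" "sup x t \<in> Q" and "x \<notin> Q"
      using quot_meets xy by blast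
    then obtain u where "u \<in> T" "sup t u \<in> Q"
      using quot_meets[of t x] by (auto simp: sup_commute)
    then show False
      using t(1) sup_closed Q(3) by blast
  qed
  moreover have "Q \<noteq> UNIV"
    using Q(3) \<open>T \<noteq> {}\<close> by blast
  ultimately have "prime_filter Q"
    using Q(1) by (auto simp: prime_filter_def proper_filter_def)
  then show ?thesis
    using Q that by blast
qed

section \<open>Minimal prime filters\<close>

lemma prime_filter_sup:
  fixes P :: "'a::residuated_lattice set"
  assumes "prime_filter P"
  shows "sup x y \<in> P \<longleftrightarrow> x \<in> P \<or> y \<in> P"
proof -
  have "rl_filter P"
    using assms by (simp add: prime_filter_def proper_filter_def)
  then show ?thesis
    using assms rl_filter_upward[OF _ _ sup_ge1] rl_filter_upward[OF _ _ sup_ge2]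
    unfolding prime_filter_def by blast
qed

lemma bot_notin_prime_filter:
  fixes P :: "'a::residuated_lattice set"
  assumes "prime_filter P"
  shows "bot \<notin> P"
proof
  assume "bot \<in> P"
  then have "P = UNIV"
    using assms rl_filter_upward[of P bot] by (auto simp: prime_filter_def proper_filter_def)
  then show False
    using assms by (simp add: prime_filter_def proper_filter_def)
qed

lemma filter_quot_subset_prime:
  fixes P :: "'a::residuated_lattice set"
  assumes "prime_filter P" and "F \<subseteq> P" and "x \<notin> P"
  shows "filter_quot F x \<subseteq> P"
  using assms prime_filter_sup by (auto simp: filter_quot_def)

lemma filter_D_subset_prime:
  fixes P :: "'a::residuated_lattice set"
  assumes "prime_filter P" and "F \<subseteq> P"
  shows "filter_D F P \<subseteq> P"
  using assms prime_filter_sup by (auto simp: filter_D_def)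

lemma mem_filter_D_iff:
  fixes F :: "'a::residuated_lattice set"
  shows "x \<in> filter_D F P \<longleftrightarrow> \<not> filter_quot F x \<subseteq> P"
  by (auto simp: filter_D_def filter_quot_def sup_commute)

lemma minimal_prime_filterI:
  fixes P :: "'a::residuated_lattice set"
  assumes P: "prime_filter P" "F \<subseteq> P" and D: "P \<subseteq> filter_D F P"
  shows "minimal_prime_filter F P"
proof -
  have "P \<subseteq> Q" if Q: "prime_filter Q" "F \<subseteq> Q" "Q \<subseteq> P" for Q
  proof
    fix a assume "a \<in> P"
    then obtain x where "x \<notin> P" "sup x a \<in> F"
      using D by (auto simp: filter_D_def)
    then show "a \<in> Q"
      using Q prime_filter_sup[OF Q(1)] by blast
  qed
  then show ?thesis
    using P by (auto simp: minimal_prime_filter_def)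
qed

text \<open>
  A point \<open>a\<close> of \<open>P\<close> outside \<open>filter_D F P\<close> can be removed: some prime filter between \<open>F\<close> and \<open>P\<close>
  omits it.
\<close>

lemma minimal_prime_filterD:
  fixes P :: "'a::residuated_lattice set"
  assumes F: "rl_filter F" and min: "minimal_prime_filter F P"
  shows "P \<subseteq> filter_D F P"
proof (rule ccontr)
  assume "\<not> P \<subseteq> filter_D F P"
  then obtain a where a: "a \<in> P" "a \<notin> filter_D F P" by blast
  have P: "prime_filter P" "F \<subseteq> P"
    using min by (simp_all add: minimal_prime_filter_def)
  define T where "T = - P \<union> (\<lambda>s. sup s a) ` (- P)"
  \<comment> \<open>Since \<open>bot \<notin> P\<close>, the set \<open>T\<close> contains \<open>a = sup bot a\<close>.\<close>
  have "sup bot a \<in> T"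
    unfolding T_def using bot_notin_prime_filter[OF P(1)] by blast
  then have "a \<in> T" by simp
  have "F \<inter> T = {}"
    using P(2) a(2) by (auto simp: T_def filter_D_def)
  moreover have "sup t u \<in> T" if "t \<in> T" "u \<in> T" for t u
  proof -
    have T_iff: "v \<in> T \<longleftrightarrow> (\<exists>s. s \<notin> P \<and> (v = s \<or> v = sup s a))" for v
      by (auto simp: T_def)
    from that obtain s r where "s \<notin> P" "r \<notin> P"
      and "t = s \<or> t = sup s a" "u = r \<or> u = sup r a"
      unfolding T_iff by blast
    then have "sup s r \<notin> P" "sup t u = sup s r \<or> sup t u = sup (sup s r) a"
      using prime_filter_sup[OF P(1)] by (auto simp: sup.assoc sup.commute sup.left_commute)
    then show ?thesis
      unfolding T_iff by blast
  qed
  ultimately obtain Q where Q: "prime_filter Q" "F \<subseteq> Q" "Q \<inter> T = {}"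
    using prime_filter_separation[OF F] \<open>a \<in> T\<close> by blast
  then have "Q \<subseteq> P"
    by (auto simp: T_def)
  then have "Q = P"
    using min Q by (auto simp: minimal_prime_filter_def)
  then show False
    using Q(3) \<open>a \<in> T\<close> a(1) by blast
qed

theorem theorem3p14:
  fixes F P :: "'a::residuated_lattice set"
  assumes "rl_filter F"
    and "prime_filter P"
    and "F \<subseteq> P"
  shows "(minimal_prime_filter F P \<longleftrightarrow> P = filter_D F P)
    \<and> (P = filter_D F P \<longleftrightarrow> (\<forall>x. (x \<in> P) \<noteq> (filter_quot F x \<subseteq> P)))"
proof -
  have D_eq: "P = filter_D F P \<longleftrightarrow> P \<subseteq> filter_D F P"
    using filter_D_subset_prime[OF assms(2,3)] by blast
  have "minimal_prime_filter F P \<longleftrightarrow> P \<subseteq> filter_D F P"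
    using minimal_prime_filterI[OF assms(2,3)] minimal_prime_filterD[OF assms(1)] by blast
  moreover have "P \<subseteq> filter_D F P \<longleftrightarrow> (\<forall>x. (x \<in> P) \<noteq> (filter_quot F x \<subseteq> P))"
    using filter_quot_subset_prime[OF assms(2,3)] mem_filter_D_iff[of _ F P] by blast
  ultimately show ?thesis
    using D_eq by blast
qed

end
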